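(* For every integer $n\ge 1$, the derivation $\partial_n$ on $\mathfrak H=\mathbb Q\langle x,y\rangle$ is given by the following identity of $\mathbb Q$-linear maps on $\mathfrak H$: $$\partial_n=\frac{n}{2^n-1}\sum_{d=1}^n\frac{(-1)^{d+1}}{d}\sum_{\substack{m_1+\dots+m_d=n\\ m_1,\dots,m_d\ge 1}}\lambda_{m_1}\cdots\lambda_{m_d},$$ where $\lambda_{m_1}\cdots\lambda_{m_d}$ denotes the rooted tree map corresponding to the forest consisting of the ladder trees $\lambda_{m_1},\dots,\lambda_{m_d}$.
   Context: **Forests.** A rooted tree is a finite connected graph without cycles with a distinguished vertex (the root); trees are considered without plane structure. A (rooted) forest is a finite product (disjoint union) of rooted trees. $\mathcal H$ is the commutative $\mathbb Q$-algebra of forests generated by all rooted trees, with unit $\mathbb I$ (the empty forest). The linear map $B_+:\mathcal H\to\mathcal H$ sends a forest to the tree obtained by connecting all roots of its trees to a new root ($B_+(\mathbb I)$ is the one-vertex tree). Every tree $t$ is $t=B_+(f_t)$ for a unique forest $f_t$. The Connes–Kreimer coproduct $\Delta:\mathcal H\to\mathcal H\otimes\mathcal H$ is defined recursively by $\Delta(\mathbb I)=\mathbb I\otimes\mathbb I$, $\Delta(t)=t\otimes\mathbb I+(\mathrm{id}\otimes B_+)\circ\Delta(f_t)$ for a tree $t$, and $\Delta(gh)=\Delta(g)\Delta(h)$ for forests $g,h$. **Ladder trees.** $\lambda_0=\mathbb I$ and $\lambda_m=B_+(\lambda_{m-1})$ for $m\ge1$, i.e. $\lambda_m$ is the tree with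 $m$ vertices and no branches. **Rooted tree maps.** Let $\mathfrak H=\mathbb Q\langle x,y\rangle$ be the noncommutative polynomial algebra (with concatenation product). To each forest $f$ one assigns a $\mathbb Q$-linear map on $\mathfrak H$, also denoted $f$ (extended $\mathbb Q$-linearly in $f$ to $\mathcal H$). The map of $\mathbb I$ is the identity. For a non-empty forest $f$ one has $f(1)=0$, and for a word $w$ and a letter $u\in\{x,y\}$, $$f(wu)=M(\Delta(f)(w\otimes u)),\qquad M(w_1\otimes w_2)=w_1w_2,$$ where $(f_1\otimes f_2)(w\otimes u)=f_1(w)\otimes f_2(u)$. On letters $u\in\{x,y\}$ the map $f$ is defined by: (i) if $f$ is the one-vertex tree, $f(x)=xy$ and $f(y)=-xy$; (ii) if $t=B_+(f)$ is a tree with $f\neq\mathbb I$, $t(u)=R_yR_{x+2y}R_y^{-1}f(u)$, where $R_v(w)=wv$ for $v,w\in\mathfrak H$; (iii) if $f=gh$ with forests $g,h\ne\mathbb I$, $f(u)=g(h(u))$. This is known to be well defined (in particular $f(u)\in\mathfrak H y$ in (ii), and the result in (iii) does not depend on the factorization). **Derivation.** For $n\ge1$, $\partial_n$ is the derivation on $\mathfrak H$ (with respect to the concatenation product) determined by $\partial_n(x)=x(x+y)^{n-1}y$ and $\partial_n(y)=-x(x+y)^{n-1}y$. *)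

theory Defs
  imports Complex_Main "HOL-Library.Multiset" "HOL-Library.Product_Plus" "HOL-Library.Poly_Mapping"
begin

section \<open>Linear maps out of spaces with a basis\<close>

text \<open>
  \<^typ>\<open>'a \<Rightarrow>\<^sub>0 rat\<close> is the \<open>\<rat>\<close>-vector space with basis \<^typ>\<open>'a\<close>; when \<^typ>\<open>'a\<close> is an
  (additively written) monoid, the library's product on it is that of the monoid algebra.
\<close>

definition scal :: "rat \<Rightarrow> ('a \<Rightarrow>\<^sub>0 rat) \<Rightarrow> 'a \<Rightarrow>\<^sub>0 rat" where
  "scal c p = Poly_Mapping.map ((*) c) p"

definition linext :: "('a \<Rightarrow> 'b \<Rightarrow>\<^sub>0 rat) \<Rightarrow> ('a \<Rightarrow>\<^sub>0 rat) \<Rightarrow> 'b \<Rightarrow>\<^sub>0 rat" where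
  "linext \<phi> p = (\<Sum>a\<in>Poly_Mapping.keys p. scal (Poly_Mapping.lookup p a) (\<phi> a))"

lemma lookup_scal [simp]: "Poly_Mapping.lookup (scal c p) a = c * Poly_Mapping.lookup p a"
  by (simp add: scal_def Poly_Mapping.map.rep_eq when_def)

lemma scal_zero [simp]: "scal 0 p = 0" "scal c 0 = 0"
  by (auto intro: poly_mapping_eqI)

lemma scal_one [simp]: "scal 1 p = p"
  by (auto intro: poly_mapping_eqI)

lemma scal_add: "scal c (p + q) = scal c p + scal c q"
  by (auto intro: poly_mapping_eqI simp: lookup_add algebra_simps)

lemma scal_add_left: "scal (c + d) p = scal c p + scal d p"
  by (auto intro: poly_mapping_eqI simp: lookup_add algebra_simps)

lemma scal_scal: "scal c (scal d p) = scal (c * d) p"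
  by (auto intro: poly_mapping_eqI simp: algebra_simps)

lemma linext_cong [fundef_cong]:
  assumes "p = q" and "\<And>a. a \<in> Poly_Mapping.keys q \<Longrightarrow> \<phi> a = \<psi> a"
  shows "linext \<phi> p = linext \<psi> q"
  using assms by (simp add: linext_def)

lemma linext_superset:
  assumes "finite A" "Poly_Mapping.keys p \<subseteq> A"
  shows "linext \<phi> p = (\<Sum>a\<in>A. scal (Poly_Mapping.lookup p a) (\<phi> a))"
  unfolding linext_def
  by (rule sum.mono_neutral_left) (use assms in \<open>auto simp: in_keys_iff\<close>)

lemma linext_add: "linext \<phi> (p + q) = linext \<phi> p + linext \<phi> q"
proof -
  let ?A = "Poly_Mapping.keys p \<union> Poly_Mapping.keys q"
  have "finite ?A" by simp
  moreover have "Poly_Mapping.keys (p + q) \<subseteq> ?A" by (rule keys_add)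
  ultimately show ?thesis
    by (simp add: linext_superset[of ?A] lookup_add scal_add_left sum.distrib)
qed

lemma linext_zero [simp]: "linext \<phi> 0 = 0"
  by (simp add: linext_def)

lemma linext_scal: "linext \<phi> (scal c p) = scal c (linext \<phi> p)"
proof -
  have "Poly_Mapping.keys (scal c p) \<subseteq> Poly_Mapping.keys p"
    by (auto simp: in_keys_iff)
  hence "linext \<phi> (scal c p) = (\<Sum>a\<in>Poly_Mapping.keys p. scal c (scal (Poly_Mapping.lookup p a) (\<phi> a)))"
    by (simp add: linext_superset[OF finite_keys] scal_scal)
  also have "\<dots> = scal c (linext \<phi> p)"
    unfolding linext_def by (rule sum_comp_morphism[of "scal c", unfolded comp_def]) (simp_all add: scal_add)
  finally show ?thesis .
qed

lemma linext_single [simp]: "linext \<phi> (Poly_Mapping.single a c) = scal c (\<phi> a)"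
  by (simp add: linext_def)

lemma keys_linext: "Poly_Mapping.keys (linext \<phi> p) \<subseteq> (\<Union>a\<in>Poly_Mapping.keys p. Poly_Mapping.keys (\<phi> a))"
proof
  fix b assume "b \<in> Poly_Mapping.keys (linext \<phi> p)"
  hence "(\<Sum>a\<in>Poly_Mapping.keys p. Poly_Mapping.lookup p a * Poly_Mapping.lookup (\<phi> a) b) \<noteq> 0"
    by (simp add: in_keys_iff linext_def lookup_sum)
  then obtain a where "a \<in> Poly_Mapping.keys p" "Poly_Mapping.lookup p a * Poly_Mapping.lookup (\<phi> a) b \<noteq> 0"
    by (meson sum.not_neutral_contains_not_neutral)
  thus "b \<in> (\<Union>a\<in>Poly_Mapping.keys p. Poly_Mapping.keys (\<phi> a))"
    by (auto simp: in_keys_iff)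
qed


lemma scal_single: "scal c (Poly_Mapping.single a b) = Poly_Mapping.single a (c * b)"
  by (rule poly_mapping_eqI) (simp add: lookup_single when_def)

lemma basis_induct [case_names zero add single]:
  fixes p :: "'a \<Rightarrow>\<^sub>0 rat"
  assumes "P 0" and add: "\<And>p q. P p \<Longrightarrow> P q \<Longrightarrow> P (p + q)" and "\<And>a c. P (Poly_Mapping.single a c)"
  shows "P p"
proof -
  have "P (\<Sum>a\<in>A. Poly_Mapping.single a (Poly_Mapping.lookup p a))" if "finite A" for A
    using that by (induction A) (auto intro: assms)
  moreover have "p = (\<Sum>a\<in>Poly_Mapping.keys p. Poly_Mapping.single a (Poly_Mapping.lookup p a))"
    by (rule poly_mapping_eqI) (auto simp: lookup_sum lookup_single when_def in_keys_iff)
  ultimately show ?thesis by (metis finite_keys)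
qed


section \<open>Forests and the Connes--Kreimer coproduct\<close>

text \<open>
  A forest is the multiset of its trees: \<^term>\<open>0\<close> is the empty forest and \<open>+\<close> is the product
  (disjoint union) of forests. \<open>Node f\<close> is the tree \<open>B\<^sub>+(f)\<close>.
\<close>

datatype tree = Node (subforest: "tree multiset")

type_synonym forest = "tree multiset"

definition Bplus :: "forest \<Rightarrow> forest" where
  "Bplus f = {#Node f#}"

text \<open>
  The forests form a basis of \<open>\<H>\<close>, so \<open>\<H> \<otimes> \<H>\<close> has the basis of pairs \<open>(f, g)\<close>, standing for
  \<open>f \<otimes> g\<close>, and its product is the one induced by the componentwise product of pairs.
\<close>

type_synonym tensor = "(forest \<times> forest) \<Rightarrow>\<^sub>0 rat"

abbreviation pure_tensor :: "forest \<Rightarrow> forest \<Rightarrow> tensor" where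
  "pure_tensor f g \<equiv> Poly_Mapping.single (f, g) 1"

definition id_tensor_Bplus :: "tensor \<Rightarrow> tensor" where
  "id_tensor_Bplus = linext (\<lambda>(f, g). pure_tensor f (Bplus g))"

primrec coproduct_tree :: "tree \<Rightarrow> tensor" where
  "coproduct_tree (Node f) =
     pure_tensor (Bplus f) 0 + id_tensor_Bplus (prod_mset (image_mset coproduct_tree f))"

definition coproduct :: "forest \<Rightarrow> tensor" where
  "coproduct f = prod_mset (image_mset coproduct_tree f)"

lemma coproduct_empty: "coproduct 0 = pure_tensor 0 0"
  by (simp add: coproduct_def flip: single_one zero_prod_def)

lemma coproduct_Bplus: "coproduct (Bplus f) = pure_tensor (Bplus f) 0 + id_tensor_Bplus (coproduct f)"
  by (simp add: coproduct_def Bplus_def)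

lemma coproduct_prod: "coproduct (g + h) = coproduct g * coproduct h"
  by (simp add: coproduct_def)

primrec nodes_tree :: "tree \<Rightarrow> nat" where
  "nodes_tree (Node f) = Suc (sum_mset (image_mset nodes_tree f))"

definition nodes :: "forest \<Rightarrow> nat" where
  "nodes f = sum_mset (image_mset nodes_tree f)"

lemma nodes_simps [simp]:
  "nodes 0 = 0" "nodes {#} = 0" "nodes (f + g) = nodes f + nodes g" "nodes (Bplus f) = Suc (nodes f)"
  by (simp_all add: nodes_def Bplus_def)

lemma nodes_pos: "f \<noteq> 0 \<Longrightarrow> 0 < nodes f"
proof (cases f)
  case (add t g)
  then show ?thesis by (cases t) (simp add: nodes_def)
qed auto

lemma keys_mult_graded:
  fixes T U :: tensor
  assumes "\<And>p. p \<in> Poly_Mapping.keys T \<Longrightarrow> nodes (fst p) + nodes (snd p) = m"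
    and "\<And>p. p \<in> Poly_Mapping.keys U \<Longrightarrow> nodes (fst p) + nodes (snd p) = n"
    and "p \<in> Poly_Mapping.keys (T * U)"
  shows "nodes (fst p) + nodes (snd p) = m + n"
proof -
  obtain a b where "p = a + b" "a \<in> Poly_Mapping.keys T" "b \<in> Poly_Mapping.keys U"
    using assms(3) keys_mult[of T U] by blast
  thus ?thesis using assms(1)[of a] assms(2)[of b] by simp
qed

lemma keys_prod_mset_graded:
  assumes "\<And>t p. t \<in># f \<Longrightarrow> p \<in> Poly_Mapping.keys (coproduct_tree t) \<Longrightarrow> nodes (fst p) + nodes (snd p) = nodes_tree t"
    and "p \<in> Poly_Mapping.keys (coproduct f)"
  shows "nodes (fst p) + nodes (snd p) = nodes f"
  using assms
proof (induction f arbitrary: p)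
  case empty
  then show ?case by (simp add: coproduct_def)
next
  case (add t f)
  have 1: "coproduct (add_mset t f) = coproduct_tree t * coproduct f"
    by (simp add: coproduct_def)
  have 2: "nodes (add_mset t f) = nodes_tree t + nodes f"
    by (simp add: nodes_def)
  show ?case unfolding 2
    by (rule keys_mult_graded[of "coproduct_tree t" _ "coproduct f"])
       (use add 1 in \<open>auto\<close>)
qed

lemma keys_coproduct_tree:
  "p \<in> Poly_Mapping.keys (coproduct_tree t) \<Longrightarrow> nodes (fst p) + nodes (snd p) = nodes_tree t"
proof (induction t arbitrary: p)
  case (Node f)
  have *: "nodes (fst q) + nodes (snd q) = nodes f" if "q \<in> Poly_Mapping.keys (coproduct f)" for q
    using keys_prod_mset_graded[OF _ that] Node.IH by auto
  have "p = (Bplus f, 0) \<or> p \<in> Poly_Mapping.keys (id_tensor_Bplus (coproduct f))"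
    using Node.prems keys_add[of "pure_tensor (Bplus f) 0" "id_tensor_Bplus (coproduct f)"]
    by (auto simp flip: coproduct_def)
  thus ?case
  proof
    assume "p \<in> Poly_Mapping.keys (id_tensor_Bplus (coproduct f))"
    then obtain g h where "(g, h) \<in> Poly_Mapping.keys (coproduct f)" "p = (g, Bplus h)"
      unfolding id_tensor_Bplus_def using keys_linext by fastforce
    thus ?thesis using *[of "(g, h)"] by (simp flip: nodes_def)
  qed (simp add: nodes_def Bplus_def)
qed

lemma keys_coproduct:
  "(g, h) \<in> Poly_Mapping.keys (coproduct f) \<Longrightarrow> nodes g + nodes h = nodes f"
  using keys_prod_mset_graded[of f "(g, h)"] keys_coproduct_tree by auto

lemma coproduct_counit:
  "\<exists>U. coproduct f = pure_tensor 0 f + U \<and> (\<forall>p\<in>Poly_Mapping.keys U. fst p \<noteq> 0)"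
proof (induction "nodes f" arbitrary: f rule: less_induct)
  case less
  show ?case
  proof (cases f)
    case empty
    thus ?thesis by (intro exI[of _ 0]) (use coproduct_empty in simp)
  next
    case (add t h)
    obtain e where t: "t = Node e" by (cases t)
    have f: "f = Bplus e + h" by (simp add: add t Bplus_def)
    obtain U where U: "coproduct e = pure_tensor 0 e + U" "\<And>p. p \<in> Poly_Mapping.keys U \<Longrightarrow> fst p \<noteq> 0"
      using less[of e] by (auto simp: f)
    obtain V where V: "coproduct h = pure_tensor 0 h + V" "\<And>p. p \<in> Poly_Mapping.keys V \<Longrightarrow> fst p \<noteq> 0"
      using less[of h] by (auto simp: f)
    let ?W = "pure_tensor (Bplus e) 0 + id_tensor_Bplus U"
    have W: "fst p \<noteq> 0" if "p \<in> Poly_Mapping.keys ?W" for p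
    proof -
      have "p = (Bplus e, 0) \<or> p \<in> Poly_Mapping.keys (id_tensor_Bplus U)"
        using that keys_add[of "pure_tensor (Bplus e) 0" "id_tensor_Bplus U"] by auto
      thus ?thesis
      proof
        assume "p \<in> Poly_Mapping.keys (id_tensor_Bplus U)"
        then obtain g k where "(g, k) \<in> Poly_Mapping.keys U" "p = (g, Bplus k)"
          unfolding id_tensor_Bplus_def using keys_linext by fastforce
        thus ?thesis using U(2)[of "(g, k)"] by simp
      qed (simp add: Bplus_def)
    qed
    let ?A = "pure_tensor 0 (Bplus e)" and ?B = "pure_tensor 0 h"
    have "coproduct (Bplus e) = ?A + ?W"
      by (simp add: coproduct_Bplus U(1) id_tensor_Bplus_def linext_add)
    hence "coproduct f = ?A * ?B + (?A * V + ?W * ?B + ?W * V)"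
      by (simp add: f coproduct_prod V(1) algebra_simps)
    moreover have "?A * ?B = pure_tensor 0 f"
      by (simp add: mult_single f)
    moreover have "fst p \<noteq> 0" if "p \<in> Poly_Mapping.keys (?A * V + ?W * ?B + ?W * V)" for p
    proof -
      have "p \<in> Poly_Mapping.keys (?A * V) \<or> p \<in> Poly_Mapping.keys (?W * ?B) \<or> p \<in> Poly_Mapping.keys (?W * V)"
        using that keys_add[of "?A * V + ?W * ?B" "?W * V"] keys_add[of "?A * V" "?W * ?B"] by blast
      moreover have "\<exists>a b. p = a + b \<and> a \<in> Poly_Mapping.keys S \<and> b \<in> Poly_Mapping.keys T"
        if "p \<in> Poly_Mapping.keys (S * T)" for S T :: tensor
        using that keys_mult[of S T] by blast
      ultimately obtain a b where "p = a + b" "fst a \<noteq> 0 \<or> fst b \<noteq> 0"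
        using V(2) W by metis
      thus ?thesis by auto
    qed
    ultimately show ?thesis by (intro exI[of _ "?A * V + ?W * ?B + ?W * V"]) auto
  qed
qed


section \<open>The noncommutative polynomial algebra\<close>

datatype letter = X | Y

text \<open>Words form the free monoid, with concatenation written additively.\<close>

instantiation list :: (type) monoid_add
begin
definition zero_list :: "'a list" where "zero_list = []"
definition plus_list :: "'a list \<Rightarrow> 'a list \<Rightarrow> 'a list" where "plus_list = (@)"
instance by standard (simp_all add: zero_list_def plus_list_def)
end

type_synonym word = "letter list"
type_synonym ncpoly = "word \<Rightarrow>\<^sub>0 rat"

definition word :: "word \<Rightarrow> ncpoly" where
  "word w = Poly_Mapping.single w 1"

abbreviation letter :: "letter \<Rightarrow> ncpoly" where
  "letter u \<equiv> word [u]"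

abbreviation gx :: ncpoly where "gx \<equiv> letter X"
abbreviation gy :: ncpoly where "gy \<equiv> letter Y"

definition rmult :: "ncpoly \<Rightarrow> ncpoly \<Rightarrow> ncpoly" where
  "rmult v w = w * v"

lemma word_Nil: "word [] = 1"
  by (simp add: word_def flip: zero_list_def)

lemma word_append: "word (v @ w) = word v * word w"
  by (simp add: word_def mult_single plus_list_def)

lemma scal_mult_left: "scal c p * q = scal c (p * q)" for p q :: ncpoly
  by (simp add: scal_def mult_map_scale_conv_mult mult.assoc)

lemma scal_mult_right: "p * scal c q = scal c (p * q)" for p q :: ncpoly
proof (induction p rule: basis_induct)
  case (single v a)
  show ?case
  proof (induction q rule: basis_induct)
    case (single w b)
    show ?case by (simp add: scal_single mult_single mult.left_commute)
  qed (simp_all add: algebra_simps scal_add)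
qed (simp_all add: algebra_simps scal_add)

section \<open>Rooted tree maps\<close>

text \<open>
  \<open>rtm_word f w\<close> is the image of the word \<open>w\<close> under the map of the forest \<open>f\<close>. On a letter \<open>u\<close>, a
  forest that is not a tree acts by \<open>f(u) = g(h(u))\<close>; this is known not to depend on the
  factorization \<open>f = gh\<close> into nonempty forests, and the recursion uses an unspecified one. The map
  \<open>R\<^sub>y\<close> is injective, so \<^term>\<open>inv (rmult gy)\<close> is its inverse on the left ideal of polynomials ending in \<open>y\<close>. The coproduct rule for
  \<open>f(wu)\<close> is used in the recursion for nonempty \<open>w\<close> only (for empty \<open>w\<close> it would be circular);
  \<open>rtm_concat\<close> below shows that it holds for all \<open>w\<close>.
\<close>

definition is_factorization :: "forest \<Rightarrow> forest \<times> forest \<Rightarrow> bool" where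
  "is_factorization f = (\<lambda>(g, h). f = g + h \<and> g \<noteq> 0 \<and> h \<noteq> 0)"

definition factorization :: "forest \<Rightarrow> forest \<times> forest" where
  "factorization f = (SOME p. is_factorization f p)"

lemma factorization_exists:
  assumes "f \<noteq> 0" "\<nexists>g. f = Bplus g"
  shows "is_factorization f (factorization f)"
proof -
  obtain t h where f: "f = add_mset t h" using assms(1) by (cases f) auto
  have "h \<noteq> 0" using assms(2) f by (cases t) (auto simp: Bplus_def)
  hence "is_factorization f ({#t#}, h)" using f by (simp add: is_factorization_def)
  thus ?thesis unfolding factorization_def by (rule someI)
qed

function rtm_word :: "forest \<Rightarrow> word \<Rightarrow> ncpoly" where
  "rtm_word f w =
    (if f = 0 then word w
     else if w = [] then 0
     else if length w > 1 then
       linext (\<lambda>(f1, f2). rtm_word f1 (butlast w) * rtm_word f2 [last w]) (coproduct f)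
     else if f = Bplus 0 then (case last w of X \<Rightarrow> gx * gy | Y \<Rightarrow> - (gx * gy))
     else if \<exists>g. f = Bplus g then
       rmult gy (rmult (gx + 2 * gy) (inv (rmult gy) (rtm_word (THE g. f = Bplus g) w)))
     else linext (\<lambda>v. rtm_word (fst (factorization f)) v) (rtm_word (snd (factorization f)) w))"
  by pat_completeness auto
termination
proof (relation "measures [\<lambda>(f, w). nodes f, \<lambda>(f, w). length w]", goal_cases)
  case (4 f w)
  then obtain g where "f = Bplus g" by blast
  thus ?case by (simp add: Bplus_def) (simp add: nodes_def)
next
  case (5 f w)
  hence "is_factorization f (factorization f)" using factorization_exists by simp
  hence "f = fst (factorization f) + snd (factorization f)" "fst (factorization f) \<noteq> 0"
    by (auto simp: is_factorization_def split: prod.splits)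
  hence "nodes (snd (factorization f)) < nodes f"
    by (metis nodes_pos nodes_simps(3) less_add_same_cancel2)
  thus ?case by simp
next
  case (6 f w v)
  hence "is_factorization f (factorization f)" using factorization_exists by simp
  hence "f = fst (factorization f) + snd (factorization f)" "snd (factorization f) \<noteq> 0"
    by (auto simp: is_factorization_def split: prod.splits)
  hence "nodes (fst (factorization f)) < nodes f"
    by (metis nodes_pos nodes_simps(3) less_add_same_cancel1)
  thus ?case by simp
qed (auto dest!: keys_coproduct)

declare rtm_word.simps [simp del]

definition rtm :: "forest \<Rightarrow> ncpoly \<Rightarrow> ncpoly" where
  "rtm f = linext (rtm_word f)"

lemma rtm_word [simp]: "rtm f (word w) = rtm_word f w"
  by (simp add: rtm_def word_def)

lemma rtm_empty: "rtm 0 p = p"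
proof (induction p rule: basis_induct)
  case (single w c)
  show ?case by (simp add: rtm_def rtm_word.simps scal_single word_def)
qed (simp_all add: rtm_def linext_add)

lemma rtm_one: "f \<noteq> 0 \<Longrightarrow> rtm f 1 = 0"
  by (simp add: rtm_word.simps[of f "[]"] flip: word_Nil)

lemma rtm_concat:
  assumes "f \<noteq> 0"
  shows "rtm f (word w * letter u) = linext (\<lambda>(f1, f2). rtm f1 (word w) * rtm f2 (letter u)) (coproduct f)"
proof (cases "w = []")
  case False
  thus ?thesis using assms
    by (simp add: rtm_word.simps[of f "w @ [u]"] flip: word_append)
next
  case True
  obtain U where U: "coproduct f = pure_tensor 0 f + U" "\<forall>p\<in>Poly_Mapping.keys U. fst p \<noteq> 0"
    using coproduct_counit by blast
  have "linext (\<lambda>(f1, f2). rtm f1 1 * rtm f2 (letter u)) U = linext (\<lambda>_. 0) U"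
    by (rule linext_cong) (use U(2) in \<open>auto simp: rtm_one\<close>)
  also have "\<dots> = 0" by (simp add: linext_def)
  finally show ?thesis by (simp add: True word_Nil U(1) linext_add rtm_empty del: rtm_word) 
qed

lemma rtm_vertex: "rtm (Bplus 0) gx = gx * gy" "rtm (Bplus 0) gy = - (gx * gy)"
  by (simp_all add: rtm_word.simps Bplus_def)

lemma rtm_Bplus:
  "f \<noteq> 0 \<Longrightarrow> rtm (Bplus f) (letter u) = rmult gy (rmult (gx + 2 * gy) (inv (rmult gy) (rtm f (letter u))))"
  by (simp add: rtm_word.simps[of "{#Node f#}" "[u]"] Bplus_def)

lemma rtm_prod:
  assumes "is_factorization f (factorization f)"
  shows "rtm f (letter u) = rtm (fst (factorization f)) (rtm (snd (factorization f)) (letter u))"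
proof -
  have "f = fst (factorization f) + snd (factorization f)"
       "fst (factorization f) \<noteq> 0" "snd (factorization f) \<noteq> 0"
    using assms by (auto simp: is_factorization_def split: prod.splits)
  then obtain g h where gh: "f = g + h" "g \<noteq> 0" "h \<noteq> 0" by blast
  have "f \<noteq> 0" using gh by simp
  moreover have "\<nexists>e. f = Bplus e"
    using gh by (auto simp: Bplus_def union_is_single)
  ultimately show ?thesis
    by (simp add: rtm_word.simps[of f "[u]"]) (simp add: rtm_def)
qed


section \<open>Ladder trees and compositions\<close>

primrec ladder :: "nat \<Rightarrow> forest" where
  "ladder 0 = 0"
| "ladder (Suc m) = Bplus (ladder m)"

definition compositions :: "nat \<Rightarrow> nat \<Rightarrow> nat list set" where
  "compositions d n = {ms. length ms = d \<and> sum_list ms = n \<and> (\<forall>m\<in>set ms. m \<ge> 1)}"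

lemma finite_compositions [simp]: "finite (compositions d n)"
proof (rule finite_subset)
  show "compositions d n \<subseteq> {ms. set ms \<subseteq> {..n} \<and> length ms = d}"
    by (auto simp: compositions_def member_le_sum_list)
qed (simp add: finite_lists_length_eq)


section \<open>The derivations\<close>

fun derivation_letter :: "nat \<Rightarrow> letter \<Rightarrow> ncpoly" where
  "derivation_letter n X = gx * (gx + gy) ^ (n - 1) * gy"
| "derivation_letter n Y = - (gx * (gx + gy) ^ (n - 1) * gy)"

primrec derivation_word :: "nat \<Rightarrow> word \<Rightarrow> ncpoly" where
  "derivation_word n [] = 0"
| "derivation_word n (u # w) = derivation_letter n u * word w + letter u * derivation_word n w"

definition derivation :: "nat \<Rightarrow> ncpoly \<Rightarrow> ncpoly" where
  "derivation n = linext (derivation_word n)"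

lemma derivation_add: "derivation n (p + q) = derivation n p + derivation n q"
  and derivation_scal: "derivation n (scal c p) = scal c (derivation n p)"
  by (simp_all add: derivation_def linext_add linext_scal)

lemma derivation_of_word: "derivation n (word w) = derivation_word n w"
  by (simp add: derivation_def word_def)

lemma derivation_gx: "derivation n gx = gx * (gx + gy) ^ (n - 1) * gy"
  and derivation_gy: "derivation n gy = - (gx * (gx + gy) ^ (n - 1) * gy)"
  by (simp_all add: derivation_of_word word_Nil)

lemma derivation_word_append:
  "derivation_word n (v @ w) = derivation_word n v * word w + word v * derivation_word n w"
proof (induction v)
  case Nil
  show ?case by (simp add: word_Nil)
next
  case (Cons u v)
  have "word (u # v) = letter u * word v" using word_append[of "[u]" v] by simp
  thus ?case by (simp add: Cons word_append algebra_simps)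
qed

lemma derivation_mult: "derivation n (p * q) = derivation n p * q + p * derivation n q"
proof (induction p rule: basis_induct)
  case (single v a)
  show ?case
  proof (induction q rule: basis_induct)
    case (single w b)
    have sv: "Poly_Mapping.single v a = scal a (word v)" and sw: "Poly_Mapping.single w b = scal b (word w)"
      by (simp_all add: scal_single word_def)
    have "derivation n (word v * word w) = derivation n (word v) * word w + word v * derivation n (word w)"
      by (simp add: derivation_of_word derivation_word_append flip: word_append)
    thus ?case unfolding sv sw
      by (simp add: scal_mult_left scal_mult_right derivation_scal scal_scal scal_add mult.commute)
  qed (simp_all add: derivation_def linext_add algebra_simps)
qed (simp_all add: derivation_def linext_add algebra_simps)

end

(*
Because the coproduct of a ladder is the sum of the tensors of complementary ladders,
Lambda(T) = sum_m lambda_m T^m is an algebra homomorphism from Q<x,y> to its power series ring; it fixes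
z = x + y and maps x to x + T x G y with G = 1 / (1 - T (x + 2y)).  Both sides of
    T Lambda'(T) = (sum_k (2^k - 1) T^k d_k) o Lambda(T)
are Lambda(T)-derivations, so this identity need only be checked on x and z.  Its coefficients,
    m lambda_m = sum_k (2^k - 1) d_k lambda_(m-k),
show that the ladder maps are generated by the commuting derivations d_k and hence commute, which makes
forests of ladders act by composition.  They also say that (2^n - 1) d_n / n is the n-th
coefficient of log Lambda(T), which is the right-hand side of the theorem; the logarithm is computed in
the commutative algebra of forests.
*)
theory Submission
  imports Defs "HOL-Computational_Algebra.Formal_Power_Series"
begin

section \<open>Linear extensions\<close>

lemma scal_sum: "scal c (\<Sum>i\<in>A. f i) = (\<Sum>i\<in>A. scal c (f i))"
  by (induction A rule: infinite_finite_induct) (simp_all add: scal_add)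

lemma scal_of_nat: "scal (of_nat k) p = of_nat k * p" for p :: ncpoly
  by (induction k) (simp_all add: scal_add_left algebra_simps)

lemma linext_minus: "linext \<phi> (- p) = - linext \<phi> p"
  using linext_add[of \<phi> p "- p"] by (simp add: eq_neg_iff_add_eq_0 add.commute)

lemma linext_sum: "linext \<phi> (\<Sum>i\<in>A. f i) = (\<Sum>i\<in>A. linext \<phi> (f i))"
  by (induction A rule: infinite_finite_induct) (simp_all add: linext_add)

lemma linext_sum_fun: "linext (\<lambda>b. \<Sum>i\<in>A. \<phi> i b) T = (\<Sum>i\<in>A. linext (\<phi> i) T)"
  unfolding linext_def by (subst sum.swap) (simp add: scal_sum)

lemma linext_linext: "linext \<psi> (linext \<phi> T) = linext (\<lambda>b. linext \<psi> (\<phi> b)) T"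
  by (induction T rule: basis_induct) (simp_all add: linext_add linext_scal)

lemma linext_single_mult:
  "linext \<phi> (Poly_Mapping.single a c * U) = scal c (linext (\<lambda>b. \<phi> (a + b)) U)"
  by (induction U rule: basis_induct)
     (simp_all add: linext_add scal_add mult_single scal_scal algebra_simps)

lemma single_eq_scal_word: "Poly_Mapping.single w c = scal c (word w)"
  by (simp add: word_def scal_single)

lemma ncpoly_induct [case_names word add scal]:
  fixes p :: ncpoly
  assumes "\<And>w. P (word w)" "\<And>p q. P p \<Longrightarrow> P q \<Longrightarrow> P (p + q)" "\<And>c p. P p \<Longrightarrow> P (scal c p)"
  shows "P p"
proof (induction p rule: basis_induct)
  case zero
  show ?case using assms(3)[OF assms(1), of 0] by simp
qed (auto simp: single_eq_scal_word intro: assms)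

lemma rtm_add: "rtm f (p + q) = rtm f p + rtm f q"
  and rtm_scal: "rtm f (scal c p) = scal c (rtm f p)"
  and rtm_zero: "rtm f 0 = 0"
  and rtm_sum: "rtm f (\<Sum>i\<in>A. h i) = (\<Sum>i\<in>A. rtm f (h i))"
  and rtm_linext: "rtm f (linext \<phi> T) = linext (\<lambda>b. rtm f (\<phi> b)) T"
  by (simp_all add: rtm_def linext_add linext_scal linext_sum linext_linext)

lemma rtm_of_nat_mult: "rtm f (of_nat k * p) = of_nat k * rtm f p"
  by (simp add: rtm_scal flip: scal_of_nat)

section \<open>Ladder maps\<close>

text \<open>Deleting the last letter of every word is a left inverse. Injectivity is what gives
  \<open>inv (rmult gy)\<close> its intended value in the rule for \<open>Bplus\<close>.\<close>

lemma inj_rmult_gy: "inj (rmult gy)"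
proof (rule inj_on_inverseI)
  fix p :: ncpoly
  show "linext (\<lambda>v. word (butlast v)) (rmult gy p) = p"
  proof (induction p rule: basis_induct)
    case (single w c)
    show ?case
      by (simp add: rmult_def word_def mult_single plus_list_def scal_single)
  qed (simp_all add: rmult_def linext_add algebra_simps)
qed

lemma ladder_eq_0_iff [simp]: "ladder m = 0 \<longleftrightarrow> m = 0"
  by (cases m) (simp_all add: Bplus_def)

text \<open>Each further \<open>Bplus\<close> strips the final y, appends x + 2y and restores y, so
  one more factor x + 2y appears before the last letter.\<close>

lemma rtm_ladder_gx: "rtm (ladder (Suc m)) gx = gx * (gx + 2 * gy) ^ m * gy"
proof (induction m)
  case 0
  show ?case by (simp add: rtm_vertex del: rtm_word)
next
  case (Suc m)
  have "inv (rmult gy) (rmult gy (gx * (gx + 2 * gy) ^ m)) = gx * (gx + 2 * gy) ^ m"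
    by (simp add: inj_rmult_gy)
  thus ?case
    using rtm_Bplus[of "ladder (Suc m)" X] Suc
    by (simp add: Bplus_def rmult_def mult.assoc power_Suc2 del: rtm_word power_Suc)
qed

lemma rtm_ladder_gy: "rtm (ladder (Suc m)) gy = - (gx * (gx + 2 * gy) ^ m * gy)"
proof (induction m)
  case 0
  show ?case by (simp add: rtm_vertex del: rtm_word)
next
  case (Suc m)
  have "inv (rmult gy) (rmult gy (- (gx * (gx + 2 * gy) ^ m))) = - (gx * (gx + 2 * gy) ^ m)"
    by (simp add: inj_rmult_gy)
  thus ?case
    using rtm_Bplus[of "ladder (Suc m)" Y] Suc
    by (simp add: Bplus_def rmult_def mult.assoc power_Suc2 del: rtm_word power_Suc)
qed

lemma coproduct_ladder: "coproduct (ladder m) = (\<Sum>i\<le>m. pure_tensor (ladder i) (ladder (m - i)))"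
proof (induction m)
  case 0
  show ?case by (simp add: coproduct_empty)
next
  case (Suc m)
  \<comment> \<open>\<open>Bplus\<close> raises the second ladder by one; the missing summand i = m
    + 1 is the term \<open>pure_tensor (Bplus f) 0\<close> of the recursion.\<close>
  have "(\<Sum>i\<le>m. pure_tensor (ladder i) (Bplus (ladder (m - i)))) = (\<Sum>i\<le>m. pure_tensor (ladder i) (ladder (Suc m - i)))"
    by (rule sum.cong) (auto simp: Suc_diff_le)
  thus ?case
    using Suc by (simp add: coproduct_Bplus id_tensor_Bplus_def linext_sum)
qed

section \<open>Multiplicativity of the generating series of the ladder maps\<close>

definition ladder_series :: "ncpoly \<Rightarrow> ncpoly fps" where
  "ladder_series p = Abs_fps (\<lambda>m. rtm (ladder m) p)"

lemma ladder_series_nth [simp]: "fps_nth (ladder_series p) m = rtm (ladder m) p"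
  by (simp add: ladder_series_def)

lemma ladder_series_add: "ladder_series (p + q) = ladder_series p + ladder_series q"
  by (rule fps_ext) (simp add: rtm_add)

lemma ladder_series_one: "ladder_series 1 = 1"
  by (rule fps_ext) (simp add: rtm_one rtm_empty)

lemma ladder_series_scal: "ladder_series (scal c p) = fps_const (scal c 1) * ladder_series p"
  by (rule fps_ext) (simp add: rtm_scal scal_mult_left)

text \<open>By \<open>coproduct_ladder\<close>, the coproduct rule for ladders is exactly the Cauchy
  product of power series.\<close>

lemma ladder_series_word_letter:
  "ladder_series (word w * letter u) = ladder_series (word w) * ladder_series (letter u)"
proof (rule fps_ext)
  fix m
  show "fps_nth (ladder_series (word w * letter u)) m = fps_nth (ladder_series (word w) * ladder_series (letter u)) m"
  proof (cases "m = 0")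
    case False
    thus ?thesis
      by (simp add: rtm_concat coproduct_ladder linext_sum fps_mult_nth atLeast0AtMost del: rtm_word)
  qed (simp add: rtm_empty del: rtm_word)
qed

lemma ladder_series_mult: "ladder_series (p * q) = ladder_series p * ladder_series q"
proof (induction p rule: ncpoly_induct)
  case (word v)
  show ?case
  proof (induction q rule: ncpoly_induct)
    case (word w)
    show ?case
    proof (induction w rule: rev_induct)
      case Nil
      show ?case by (simp add: word_Nil ladder_series_one)
    next
      case (snoc u w)
      have "ladder_series (word v * word (w @ [u])) = ladder_series (word (v @ w) * letter u)"
        by (simp add: word_append mult.assoc)
      also have "\<dots> = ladder_series (word v) * ladder_series (word w * letter u)"
        using ladder_series_word_letter[of "v @ w" u] ladder_series_word_letter[of w u] snoc
        by (simp add: word_append mult.assoc)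
      finally show ?case by (simp add: word_append)
    qed
  next
    case (scal c q)
    \<comment> \<open>The coefficient ring is noncommutative, so a scalar must be seen to be central
      before it can pass the series of \<open>word v\<close>.\<close>
    have "fps_const (scal c 1) * F = F * fps_const (scal c 1)" for F :: "ncpoly fps"
      by (rule fps_ext) (simp add: scal_mult_left scal_mult_right)
    thus ?case using scal
      by (simp add: scal_mult_right ladder_series_scal flip: mult.assoc) (simp add: mult.assoc)
  qed (simp_all add: algebra_simps ladder_series_add)
qed (simp_all add: algebra_simps ladder_series_add scal_mult_left ladder_series_scal)

lemma rtm_ladder_mult:
  "rtm (ladder m) (p * q) = (\<Sum>i\<le>m. rtm (ladder i) p * rtm (ladder (m - i)) q)"
  using arg_cong[OF ladder_series_mult, of "\<lambda>F. fps_nth F m" p q]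
  by (simp add: fps_mult_nth atLeast0AtMost)

section \<open>The derivations\<close>

lemma derivation_one: "derivation n 1 = 0"
  by (simp add: derivation_of_word flip: word_Nil)

lemma derivation_minus: "derivation n (- p) = - derivation n p"
  and derivation_sum: "derivation n (\<Sum>i\<in>A. f i) = (\<Sum>i\<in>A. derivation n (f i))"
  by (simp_all add: derivation_def linext_minus linext_sum)

lemma derivation_of_nat_mult: "derivation n (of_nat k * p) = of_nat k * derivation n p"
  by (simp add: derivation_scal flip: scal_of_nat)

lemma derivation_gx_gy: "derivation n (gx + gy) = 0"
  by (simp add: derivation_add derivation_gx derivation_gy)

lemma derivation_power_gx_gy: "derivation n ((gx + gy) ^ k) = 0"
  by (induction k) (simp_all add: derivation_one derivation_mult derivation_gx_gy)

lemma derivation_commute_letter: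
  "derivation m (derivation n (letter u)) = derivation n (derivation m (letter u))"
proof -
  let ?z = "gx + gy"
  have *: "derivation m (derivation n gx) - derivation n (derivation m gx) = 0" for m n
  proof -
    \<comment> \<open>With z = x + y annihilated by both derivations, the four terms of the
      commutator pair up: the inner letters x and y add to a z in each pair.\<close>
    have "derivation m (derivation n gx) - derivation n (derivation m gx)
      = gx * ?z ^ (m - 1) * ?z * ?z ^ (n - 1) * gy - gx * ?z ^ (n - 1) * ?z * ?z ^ (m - 1) * gy"
      unfolding derivation_gx derivation_gy derivation_mult derivation_power_gx_gy
      by (simp only: distrib_left distrib_right mult.assoc mult_minus_left mult_minus_right mult_zero_left mult_zero_right add_0_left add_0_right)
         (simp add: algebra_simps)
    also have "\<dots> = 0"
      by (simp add: mult.assoc flip: power_Suc power_add) (simp add: add.commute flip: power_add mult.assoc power_Suc power_Suc2)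
    finally show ?thesis .
  qed
  have y: "derivation k gy = - derivation k gx" for k
    by (simp add: derivation_gx derivation_gy)
  show ?thesis
    using * by (cases u) (simp_all add: y derivation_minus)
qed

text \<open>On a product, the mixed terms of the two compositions agree, so commutation propagates
  from letters to words.\<close>

lemma derivation_commute: "derivation m (derivation n p) = derivation n (derivation m p)"
proof (induction p rule: ncpoly_induct)
  case (word w)
  show ?case
  proof (induction w)
    case Nil
    show ?case by (simp add: word_Nil derivation_one) (simp add: derivation_def)
  next
    case (Cons u w)
    have "word (u # w) = letter u * word w" using word_append[of "[u]" w] by simp
    thus ?case
      using Cons derivation_commute_letter[of m n u]
      by (simp add: derivation_mult derivation_add algebra_simps)
  qed
qed (simp_all add: derivation_add derivation_scal)


section \<open>The logarithmic derivative of the ladder series\<close>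

text \<open>The operator T d/dT on power series.\<close>

definition euler :: "ncpoly fps \<Rightarrow> ncpoly fps" where
  "euler F = Abs_fps (\<lambda>n. of_nat n * fps_nth F n)"

lemma euler_nth [simp]: "fps_nth (euler F) n = of_nat n * fps_nth F n"
  by (simp add: euler_def)

lemma euler_mult: "euler (F * G) = euler F * G + F * euler G"
proof (rule fps_ext)
  fix n
  have "of_nat n * (fps_nth F i * fps_nth G (n - i)) =
      of_nat i * fps_nth F i * fps_nth G (n - i) + fps_nth F i * (of_nat (n - i) * fps_nth G (n - i))"
    if "i \<le> n" for i
  proof -
    have "of_nat n = (of_nat i + of_nat (n - i) :: ncpoly)"
      using that by (simp flip: of_nat_add)
    moreover have "fps_nth F i * (of_nat (n - i) * fps_nth G (n - i)) = of_nat (n - i) * (fps_nth F i * fps_nth G (n - i))"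
      by (simp only: scal_mult_right flip: scal_of_nat)
    ultimately show ?thesis by (simp only: distrib_right mult.assoc)
  qed
  thus "fps_nth (euler (F * G)) n = fps_nth (euler F * G + F * euler G) n"
    by (simp add: fps_mult_nth sum_distrib_left flip: sum.distrib)
qed

text \<open>The weight 2^k - 1 vanishes at k = 0. This removes the k = 0 terms of the sums below,
  where truncated subtraction makes \<open>derivation 0\<close> coincide with
  \<open>derivation 1\<close>.\<close>

definition mersenne :: "nat \<Rightarrow> nat" where
  "mersenne k = 2 ^ k - 1"

text \<open>The operator sum_k (2^k - 1) T^k d_k, where d_k acts on coefficients and commutes with
  T.\<close>

definition derivation_series :: "ncpoly fps \<Rightarrow> ncpoly fps" where
  "derivation_series F = Abs_fps (\<lambda>n. \<Sum>k=0..n. of_nat (mersenne k) * derivation k (fps_nth F (n - k)))"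

lemma derivation_zero: "derivation n 0 = 0"
  by (simp add: derivation_def)

lemma derivation_series_nth [simp]:
  "fps_nth (derivation_series F) n = (\<Sum>k=0..n. of_nat (mersenne k) * derivation k (fps_nth F (n - k)))"
  by (simp add: derivation_series_def)

lemma derivation_series_add: "derivation_series (F + G) = derivation_series F + derivation_series G"
  by (rule fps_ext) (simp add: derivation_add distrib_left sum.distrib)

text \<open>Each d_k is a derivation and T^k is central, so the weighted sum is again a derivation;
  the proof only rearranges the resulting triple sums.\<close>

lemma derivation_series_mult:
  "derivation_series (F * G) = derivation_series F * G + F * derivation_series G"
proof (rule fps_ext)
  fix n
  let ?c = "\<lambda>k. of_nat (mersenne k) :: ncpoly"
  let ?F = "fps_nth F" and ?G = "fps_nth G"
  have c: "?c k * (a * derivation k b) = a * (?c k * derivation k b)" for k a b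
    by (simp only: scal_mult_right flip: scal_of_nat)
  have "fps_nth (derivation_series (F * G)) n =
      (\<Sum>k=0..n. \<Sum>i=0..n - k. ?c k * derivation k (?F i) * ?G (n - k - i))
      + (\<Sum>k=0..n. \<Sum>i=0..n - k. ?F i * (?c k * derivation k (?G (n - k - i))))"
    by (simp add: fps_mult_nth derivation_sum derivation_mult sum_distrib_left distrib_left c mult.assoc
        sum.distrib)
  also have "(\<Sum>k=0..n. \<Sum>i=0..n - k. ?c k * derivation k (?F i) * ?G (n - k - i)) = fps_nth (derivation_series F * G) n"
    using fps_mult_assoc_lemma[where k = n and f = "\<lambda>k i j. ?c k * derivation k (?F i) * ?G j"]
    by (simp add: fps_mult_nth sum_distrib_right)
  also have "(\<Sum>k=0..n. \<Sum>i=0..n - k. ?F i * (?c k * derivation k (?G (n - k - i)))) =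
      (\<Sum>i=0..n. \<Sum>k=0..n - i. ?F i * (?c k * derivation k (?G (n - i - k))))"
    unfolding sum.Sigma[OF finite_atLeastAtMost ballI[OF finite_atLeastAtMost]]
    by (rule sum.reindex_bij_witness[of _ "\<lambda>(a, b). (b, a)" "\<lambda>(a, b). (b, a)"])
       (auto simp: add.commute)
  also have "\<dots> = fps_nth (F * derivation_series G) n"
    by (simp add: fps_mult_nth sum_distrib_left)
  finally show "fps_nth (derivation_series (F * G)) n = fps_nth (derivation_series F * G + F * derivation_series G) n"
    by simp
qed

lemma derivation_series_const:
  "derivation_series (fps_const p) = Abs_fps (\<lambda>k. of_nat (mersenne k) * derivation k p)"
proof (rule fps_ext)
  fix n
  have "fps_nth (derivation_series (fps_const p)) n = (\<Sum>k=0..n. if k = n then of_nat (mersenne n) * derivation n p else 0)"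
    unfolding derivation_series_nth by (rule sum.cong) (auto simp: derivation_zero)
  thus "fps_nth (derivation_series (fps_const p)) n = fps_nth (Abs_fps (\<lambda>k. of_nat (mersenne k) * derivation k p)) n"
    by simp
qed

lemma derivation_series_X: "derivation_series fps_X = 0"
  by (rule fps_ext) (auto simp: fps_X_def derivation_zero derivation_one intro!: sum.neutral)

lemma derivation_series_one: "derivation_series 1 = 0"
  using derivation_series_const[of 1] by (simp add: derivation_one fps_zero_def)

text \<open>Here G = 1 / (1 - T (x + 2y)), and with z = x + y, Q = T / ((1 - 2Tz)(1 - Tz)). The left
  side is the derivative of x + T x G y and factors as \<open>A * Q * B\<close>. Since 2z = (x + 2y)
  + x and z = (x + 2y) - y, one gets A = x G (1 - 2Tz) and B = (1 - Tz) G y, whose inner factors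
  cancel the denominators of Q.\<close>

lemma ladder_derivation_identity:
  fixes T x y G Q :: "'a :: ring_1"
  assumes T: "\<And>a. a * T = T * a"
    and G: "G = 1 + T * (G * (x + y + y))" "G = 1 + T * ((x + y + y) * G)"
    and Q: "(1 - T * (x + y + (x + y))) * Q * (1 - T * (x + y)) = T"
  shows "x * Q * y + T * (x * Q * y * G * y) - T * T * (x * G * x * Q * y * G * y) - T * (x * G * x * Q * y)
    = T * (x * G * G * y)"
proof -
  have T0: "a * (T * b) = T * (a * b)" for a b
    by (simp only: T[of a] flip: mult.assoc)
  note T' = T0[of x] T0[of y] T0[of G] T0[of Q]
  define A where "A = x - T * (x * G * x)"
  define B where "B = y + T * (y * G * y)"
  have "x * (G * (1 - T * (x + y + (x + y)))) = x * ((G - T * (G * (x + y + y))) - T * (G * x))"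
    by (simp add: algebra_simps T')
  also have "G - T * (G * (x + y + y)) = 1"
    using G(1) by (metis add_diff_cancel_right')
  also have "x * (1 - T * (G * x)) = A"
    by (simp add: A_def right_diff_distrib mult.assoc T')
  finally have A: "A = x * (G * (1 - T * (x + y + (x + y))))" ..
  have "(1 - T * (x + y)) * G * y = ((G - T * ((x + y + y) * G)) + T * (y * G)) * y"
    by (simp add: algebra_simps)
  also have "G - T * ((x + y + y) * G) = 1"
    using G(2) by (metis add_diff_cancel_right')
  finally have B: "B = (1 - T * (x + y)) * G * y"
    by (simp add: B_def algebra_simps)
  have "x * Q * y + T * (x * Q * y * G * y) - T * T * (x * G * x * Q * y * G * y) - T * (x * G * x * Q * y)
    = A * Q * B"
    by (simp add: A_def B_def algebra_simps T')
  also have "\<dots> = x * G * ((1 - T * (x + y + (x + y))) * Q * (1 - T * (x + y))) * G * y"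
    by (simp add: A B mult.assoc)
  also have "\<dots> = T * (x * G * G * y)"
    unfolding Q by (simp add: mult.assoc T')
  finally show ?thesis .
qed

lemma fps_X_central: "F * fps_X = fps_X * F" for F :: "ncpoly fps"
  by (rule fps_mult_fps_X_commute[symmetric])

lemma euler_ladder_series_gx: "euler (ladder_series gx) = derivation_series (ladder_series gx)"
proof -
  define x y T where "x = fps_const gx" and "y = fps_const gy" and "T = (fps_X :: ncpoly fps)"
  define G where "G = Abs_fps (\<lambda>n. (gx + 2 * gy) ^ n)"
  \<comment> \<open>\<open>Q\<close> is the series between x and y in the derivative of x, and
    \<open>H\<close> is the geometric series 1 / (1 - 2Tz) for z = x + y.\<close>
  define Q where "Q = Abs_fps (\<lambda>k. of_nat (mersenne k) * (gx + gy) ^ (k - 1))"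
  define H where "H = Abs_fps (\<lambda>k. of_nat (2 ^ k) * (gx + gy) ^ k)"
  have W: "x + y + y = fps_const (gx + 2 * gy)"
    by (simp add: x_def y_def mult_2 add.assoc)
  have z: "x + y = fps_const (gx + gy)" "x + y + (x + y) = fps_const (2 * (gx + gy))"
    by (simp_all add: x_def y_def mult_2 algebra_simps)
  have T: "a * T = T * a" for a
    unfolding T_def by (rule fps_X_central)
  have T0: "a * (T * b) = T * (a * b)" for a b
    by (simp only: T[of a] flip: mult.assoc)
  have G1: "G = 1 + T * (G * (x + y + y))"
    unfolding W by (rule fps_ext) (auto simp: G_def T_def gr0_conv_Suc power_Suc2 simp del: power_Suc)
  have G2: "G = 1 + T * ((x + y + y) * G)"
    unfolding W by (rule fps_ext) (auto simp: G_def T_def gr0_conv_Suc)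

  have TH: "T * (1 - T * (x + y + (x + y))) * H = T"
  proof -
    have "H = 1 + T * ((x + y + (x + y)) * H)"
    proof (rule fps_ext)
      fix n
      have "of_nat (2 * k) * (z * w) = (z + z) * (of_nat k * w)" for k and z w :: ncpoly
        using mult_of_nat_commute[of k z, THEN arg_cong[where f = "\<lambda>a. 2 * a * w"]]
        by (simp add: mult.assoc distrib_right flip: mult_2)
      hence "of_nat (2 ^ Suc m) * (gx + gy) ^ Suc m = (gx + gy + (gx + gy)) * (of_nat (2 ^ m) * (gx + gy) ^ m)" for m
        by (simp only: power_Suc)
      thus "fps_nth H n = fps_nth (1 + T * ((x + y + (x + y)) * H)) n"
        unfolding z by (cases n) (simp_all add: H_def T_def del: of_nat_power of_nat_mult power_Suc)
    qed
    hence "T * (H - T * ((x + y + (x + y)) * H)) = T"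
      by (metis add_diff_cancel_right' mult.right_neutral)
    thus ?thesis by (simp add: left_diff_distrib mult.assoc)
  qed
  have "Q * (1 - T * (x + y)) = T * H"
  proof -
    \<comment> \<open>Coefficientwise this is 2^(m+1) - 1 = 2^m + (2^m - 1).\<close>
    have "Q = T * H + T * (Q * (x + y))"
      unfolding z
    proof (rule fps_ext)
      fix n
      show "fps_nth Q n = fps_nth (T * H + T * (Q * fps_const (gx + gy))) n"
      proof (cases n)
        case (Suc m)
        \<comment> \<open>For m = 0 the truncated exponent m - 1 breaks z^(m-1) z = z^m, but the
          coefficient of \<open>Q\<close> is then zero.\<close>
        show ?thesis
        proof (cases m)
          case 0
          thus ?thesis using Suc by (simp add: Q_def H_def T_def mersenne_def)
        next
          case (Suc k)
          have "mersenne (Suc m) = 2 ^ m + mersenne m"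
            by (simp add: mersenne_def)
          hence "fps_nth Q (Suc m) = (of_nat (2 ^ m) + of_nat (mersenne m)) * (gx + gy) ^ m"
            by (simp add: Q_def)
          also have "\<dots> = fps_nth (T * H + T * (Q * fps_const (gx + gy))) (Suc m)"
            using Suc by (simp add: Q_def H_def T_def distrib_right mult.assoc power_Suc2 del: power_Suc)
          finally show ?thesis using \<open>n = Suc m\<close> by simp
        qed
      qed (simp add: Q_def T_def mersenne_def)
    qed
    hence "Q - T * (Q * (x + y)) = T * H"
      by (metis add_diff_cancel_right')
    thus ?thesis by (simp add: right_diff_distrib T0[of Q])
  qed
  hence "(1 - T * (x + y + (x + y))) * Q * (1 - T * (x + y)) = (1 - T * (x + y + (x + y))) * T * H"
    by (simp only: mult.assoc)
  hence Q: "(1 - T * (x + y + (x + y))) * Q * (1 - T * (x + y)) = T"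
    using TH by (simp only: T[of "1 - T * (x + y + (x + y))"])
  have L: "ladder_series gx = x + T * (x * G * y)"
  proof (rule fps_ext)
    fix n
    show "fps_nth (ladder_series gx) n = fps_nth (x + T * (x * G * y)) n"
      by (cases n) (simp_all add: x_def y_def T_def G_def rtm_empty rtm_ladder_gx
          del: rtm_word ladder.simps(2))
  qed
  let ?D = derivation_series
  have Dx: "?D x = x * Q * y"
    unfolding x_def derivation_series_const
    by (rule fps_ext)
       (simp add: Q_def y_def derivation_gx scal_mult_left scal_mult_right flip: scal_of_nat)
  have Dy: "?D y = - (x * Q * y)"
    unfolding y_def derivation_series_const
    by (rule fps_ext)
       (simp add: Q_def y_def x_def derivation_gy scal_mult_left scal_mult_right flip: scal_of_nat)
  have DT: "?D T = 0"
    unfolding T_def by (rule derivation_series_X)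
  \<comment> \<open>Differentiating one geometric equation for \<open>G\<close> and multiplying by
    \<open>G\<close> on the right, where the other equation applies, gives the noncommutative rule
    for the derivative of an inverse.\<close>
  have "?D G = T * (?D G * (x + y + y) + G * ?D (x + y + y))"
    by (subst G1) (simp add: derivation_series_add derivation_series_mult derivation_series_one DT)
  hence "?D G - T * (?D G * (x + y + y)) = T * (G * ?D (x + y + y))"
    by (metis add_diff_cancel_left' distrib_left)
  hence "(?D G - T * (?D G * (x + y + y))) * G = T * (G * ?D (x + y + y) * G)"
    by (simp add: mult.assoc)
  moreover have "(?D G - T * (?D G * (x + y + y))) * G = ?D G * (G - T * ((x + y + y) * G))"
    by (simp add: left_diff_distrib right_diff_distrib mult.assoc T0[of "?D G"])
  moreover have "G - T * ((x + y + y) * G) = 1"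
    using G2 by (metis add_diff_cancel_right')
  ultimately have DG: "?D G = - (T * (G * x * Q * y * G))"
    by (simp add: derivation_series_add Dx Dy mult.assoc)
  have "?D (ladder_series gx) = x * Q * y + T * (x * Q * y * G * y) - T * T * (x * G * x * Q * y * G * y) - T * (x * G * x * Q * y)"
    unfolding L derivation_series_add derivation_series_mult Dx Dy DG DT
    by (simp add: algebra_simps T0[of x])
  also have "\<dots> = T * (x * G * G * y)"
    by (rule ladder_derivation_identity[OF T G1 G2 Q])
  also have "\<dots> = euler (ladder_series gx)"
  proof (rule fps_ext)
    fix n
    \<comment> \<open>The square of the geometric series supplies the factor m + 1 created by T
      d/dT.\<close>
    have GG: "fps_nth (G * G) m = of_nat (Suc m) * (gx + 2 * gy) ^ m" for m
      by (simp add: G_def fps_mult_nth flip: power_add)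
    have "fps_nth (x * (G * G) * y) m = of_nat (Suc m) * (gx * (gx + 2 * gy) ^ m * gy)" for m
      unfolding x_def y_def fps_mult_right_const_nth fps_mult_left_const_nth GG
      by (simp only: scal_mult_left scal_mult_right flip: scal_of_nat)
    thus "fps_nth (T * (x * G * G * y)) n = fps_nth (euler (ladder_series gx)) n"
      by (cases n) (simp_all add: T_def rtm_ladder_gx mult.assoc del: rtm_word ladder.simps(2) of_nat_Suc)
  qed
  finally show ?thesis ..
qed

text \<open>The letter y is reached through x + y: its ladder series is constant and is annihilated
  by both operators. Multiplicativity of the ladder series and the two product rules then extend the
  identity from letters to words.\<close>

lemma euler_ladder_series: "euler (ladder_series p) = derivation_series (ladder_series p)"
proof -
  have add: "euler (F + G) = euler F + euler G" for F G
    by (rule fps_ext) (simp add: distrib_left)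
  have const: "euler (fps_const c) = 0" for c
    by (rule fps_ext) simp
  have letter: "euler (ladder_series (letter u)) = derivation_series (ladder_series (letter u))" for u
  proof (cases u)
    case Y
    have "ladder_series gx + ladder_series gy = fps_const (gx + gy)"
    proof (rule fps_ext)
      fix n
      show "fps_nth (ladder_series gx + ladder_series gy) n = fps_nth (fps_const (gx + gy)) n"
        by (cases n) (simp_all add: rtm_ladder_gx rtm_ladder_gy del: rtm_word ladder.simps(2), simp add: rtm_empty del: rtm_word)
    qed
    moreover have "derivation_series (fps_const (gx + gy)) = 0"
      unfolding derivation_series_const by (rule fps_ext) (simp add: derivation_gx_gy)
    ultimately have "euler (ladder_series gx) + euler (ladder_series gy) =
        derivation_series (ladder_series gx) + derivation_series (ladder_series gy)"
      by (metis add const derivation_series_add)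
    thus ?thesis using Y euler_ladder_series_gx by simp
  qed (use euler_ladder_series_gx in simp)
  show ?thesis
  proof (induction p rule: ncpoly_induct)
    case (word w)
    show ?case
    proof (induction w rule: rev_induct)
      case Nil
      show ?case using const[of 1] by (simp add: word_Nil ladder_series_one derivation_series_one)
    next
      case (snoc u w)
      thus ?case
        by (simp add: word_append ladder_series_mult euler_mult derivation_series_mult letter)
    qed
  next
    case (scal c p)
    have "euler (ladder_series (scal c p)) = fps_const (scal c 1) * euler (ladder_series p)"
      by (simp add: ladder_series_scal euler_mult const)
    moreover have "derivation_series (fps_const (scal c 1)) = 0"
      unfolding derivation_series_const by (rule fps_ext) (simp add: derivation_scal derivation_one)
    ultimately show ?case using scal
      by (simp add: ladder_series_scal derivation_series_mult)
  qed (simp_all add: ladder_series_add add derivation_series_add)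
qed

lemma ladder_recursion:
  "of_nat m * rtm (ladder m) p = (\<Sum>k=0..m. of_nat (mersenne k) * derivation k (rtm (ladder (m - k)) p))"
  using arg_cong[OF euler_ladder_series, of "\<lambda>F. fps_nth F m" p] by simp


section \<open>Forests of ladders\<close>

lemma of_nat_mult_cancel:
  fixes p q :: ncpoly
  assumes "of_nat n * p = of_nat n * q" "n \<noteq> 0"
  shows "p = q"
proof -
  have "scal (1 / of_nat n) (scal (of_nat n) p) = scal (1 / of_nat n) (scal (of_nat n) q)"
    by (simp only: scal_of_nat assms(1))
  thus ?thesis using assms(2) by (simp add: scal_scal)
qed

text \<open>The recursion builds every ladder map from the derivations, so commuting with the latter
  suffices. It is used first with \<open>A\<close> a derivation, then with \<open>A\<close> a ladder
  map.\<close>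

lemma ladder_maps_commute_of:
  fixes A :: "ncpoly \<Rightarrow> ncpoly"
  assumes sum: "\<And>(f :: nat \<Rightarrow> ncpoly) I. A (\<Sum>i\<in>I. f i) = (\<Sum>i\<in>I. A (f i))"
    and of_nat: "\<And>k q. A (of_nat k * q) = of_nat k * A q"
    and comm: "\<And>k q. A (derivation k q) = derivation k (A q)"
  shows "A (rtm (ladder m) p) = rtm (ladder m) (A p)"
proof (induction m rule: less_induct)
  case (less m)
  show ?case
  proof (cases "m = 0")
    case False
    have "of_nat m * A (rtm (ladder m) p) = A (\<Sum>k=0..m. of_nat (mersenne k) * derivation k (rtm (ladder (m - k)) p))"
      by (simp flip: of_nat ladder_recursion)
    also have "\<dots> = (\<Sum>k=0..m. of_nat (mersenne k) * derivation k (A (rtm (ladder (m - k)) p)))"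
      by (simp add: sum of_nat comm)
    also have "\<dots> = (\<Sum>k=0..m. of_nat (mersenne k) * derivation k (rtm (ladder (m - k)) (A p)))"
    proof (rule sum.cong)
      \<comment> \<open>The term k = 0 contains the map of \<open>ladder m\<close> itself, outside
        the induction hypothesis, but its weight is zero.\<close>
      fix k assume "k \<in> {0..m}"
      thus "of_nat (mersenne k) * derivation k (A (rtm (ladder (m - k)) p)) =
          of_nat (mersenne k) * derivation k (rtm (ladder (m - k)) (A p))"
        using less[of "m - k"] False by (cases "k = 0") (simp_all add: mersenne_def)
    qed simp
    also have "\<dots> = of_nat m * rtm (ladder m) (A p)"
      by (rule ladder_recursion[symmetric])
    finally show ?thesis using False by (rule of_nat_mult_cancel)
  qed (simp add: rtm_empty)
qed

lemma derivation_rtm_ladder_commute: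
  "derivation k (rtm (ladder m) p) = rtm (ladder m) (derivation k p)"
  by (rule ladder_maps_commute_of) (simp_all add: derivation_sum derivation_of_nat_mult derivation_commute)

lemma rtm_ladder_commute: "rtm (ladder k) (rtm (ladder m) p) = rtm (ladder m) (rtm (ladder k) p)"
  by (rule ladder_maps_commute_of) (simp_all add: rtm_sum rtm_of_nat_mult derivation_rtm_ladder_commute)

section \<open>Forests of ladders act by composition\<close>

definition ladder_forest :: "forest \<Rightarrow> bool" where
  "ladder_forest f \<longleftrightarrow> (\<forall>t\<in>#f. \<exists>m. {#t#} = ladder m)"

lemma ladder_forest_zero: "ladder_forest 0"
  and ladder_forest_add: "ladder_forest (f + g) \<longleftrightarrow> ladder_forest f \<and> ladder_forest g"
  by (auto simp: ladder_forest_def)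

lemma ladder_forest_ladder: "ladder_forest (ladder m)"
proof (cases m)
  case (Suc k)
  have "{#Node (ladder k)#} = ladder (Suc k)" by (simp add: Bplus_def)
  thus ?thesis unfolding ladder_forest_def Suc by (metis add_mset_eq_single multi_member_split)
qed (simp add: ladder_forest_zero)

lemma ladder_forest_sum_list: "ladder_forest (\<Sum>m\<leftarrow>ms. ladder m)"
  by (induction ms) (simp_all add: ladder_forest_zero ladder_forest_add ladder_forest_ladder)

lemma ladder_forest_induct [consumes 1, case_names empty add]:
  assumes "ladder_forest f" "P 0" "\<And>m f. ladder_forest f \<Longrightarrow> P f \<Longrightarrow> P (ladder m + f)"
  shows "P f"
  using assms(1)
proof (induction f)
  case empty
  show ?case using assms(2) by simp
next
  case (add t f)
  obtain m where "{#t#} = ladder m" using add.prems by (auto simp: ladder_forest_def)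
  hence eq: "add_mset t f = ladder m + f" by (metis add_mset_add_single union_commute)
  have "ladder_forest f" using add.prems by (simp add: ladder_forest_def)
  thus ?case unfolding eq using add.IH by (intro assms(3))
qed

text \<open>
  The composition of the maps of the trees of a ladder forest; the remaining trees are ignored so that
  the factors always commute.
\<close>

definition composed :: "forest \<Rightarrow> ncpoly \<Rightarrow> ncpoly" where
  "composed f p = fold_mset (\<lambda>t. if \<exists>m. {#t#} = ladder m then rtm {#t#} else id) p f"

lemma composed_zero [simp]: "composed 0 p = p"
  by (simp add: composed_def)

lemma composed_add_mset:
  "composed (add_mset t f) p = (if \<exists>m. {#t#} = ladder m then rtm {#t#} else id) (composed f p)"
proof -
  \<comment> \<open>Commutation of the ladder maps makes the fold independent of the order of the
    trees.\<close>
  interpret comp_fun_commute "\<lambda>t. if \<exists>m. {#t#} = ladder m then rtm {#t#} else id"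
    by standard (auto simp: fun_eq_iff rtm_ladder_commute)
  show ?thesis by (simp add: composed_def)
qed

lemma composed_ladder_add: "composed (ladder m + f) p = rtm (ladder m) (composed f p)"
proof (cases m)
  case (Suc k)
  have eq: "{#Node (ladder k)#} = ladder (Suc k)" by (simp add: Bplus_def)
  have "composed (ladder (Suc k) + f) p = composed (add_mset (Node (ladder k)) f) p"
    by (simp add: Bplus_def)
  also have "\<dots> = rtm {#Node (ladder k)#} (composed f p)"
    unfolding composed_add_mset by (subst if_P) (rule exI, rule eq, rule refl)
  finally show ?thesis unfolding Suc eq .
qed (simp add: rtm_empty)

lemma composed_ladder: "composed (ladder m) p = rtm (ladder m) p"
  using composed_ladder_add[of m 0] by simp

lemma composed_add: "ladder_forest f \<Longrightarrow> composed (f + g) p = composed f (composed g p)"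
  by (induction f rule: ladder_forest_induct) (simp_all add: composed_ladder_add add.assoc)

lemma composed_linear:
  assumes "ladder_forest f"
  shows "composed f (linext \<phi> T) = linext (\<lambda>b. composed f (\<phi> b)) T"
  using assms
  by (induction f rule: ladder_forest_induct) (simp_all add: composed_ladder_add rtm_linext)

lemma composed_one: "ladder_forest f \<Longrightarrow> f \<noteq> 0 \<Longrightarrow> composed f 1 = 0"
proof (induction f rule: ladder_forest_induct)
  case (add m f)
  thus ?case
    by (cases "f = 0"; cases "m = 0") (auto simp: composed_ladder_add composed_ladder rtm_zero rtm_empty rtm_one)
qed simp

text \<open>The coproduct is multiplicative, so adding a ladder to the forest applies the ladder
  product rule inside each tensor of the coproduct.\<close>

lemma composed_mult:
  assumes "ladder_forest f"
  shows "composed f (p * q) = linext (\<lambda>(f1, f2). composed f1 p * composed f2 q) (coproduct f)"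
  using assms
proof (induction f rule: ladder_forest_induct)
  case empty
  show ?case by (simp add: coproduct_empty)
next
  case (add m f)
  have "composed (ladder m + f) (p * q) =
      linext (\<lambda>b. \<Sum>i\<le>m. rtm (ladder i) (composed (fst b) p) * rtm (ladder (m - i)) (composed (snd b) q)) (coproduct f)"
    by (simp add: composed_ladder_add add rtm_linext case_prod_beta rtm_ladder_mult)
  also have "\<dots> = linext (\<lambda>(f1, f2). composed f1 p * composed f2 q) (coproduct (ladder m + f))"
    by (simp add: coproduct_prod coproduct_ladder sum_distrib_right linext_sum linext_single_mult
        linext_sum_fun case_prod_beta composed_ladder_add)
  finally show ?case .
qed

text \<open>Ladder forests are closed under the coproduct, so an induction confined to them can use
  the coproduct rule.\<close>

lemma keys_coproduct_ladder_forest: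
  assumes "ladder_forest f" "p \<in> Poly_Mapping.keys (coproduct f)"
  shows "ladder_forest (fst p) \<and> ladder_forest (snd p)"
  using assms
proof (induction f arbitrary: p rule: ladder_forest_induct)
  case empty
  thus ?case by (simp add: coproduct_empty ladder_forest_zero)
next
  case (add m f)
  obtain a b where ab: "p = a + b" "a \<in> Poly_Mapping.keys (coproduct (ladder m))" "b \<in> Poly_Mapping.keys (coproduct f)"
    using add.prems keys_mult[of "coproduct (ladder m)" "coproduct f"] by (auto simp: coproduct_prod)
  have "\<exists>i\<le>m. a = (ladder i, ladder (m - i))"
    using ab(2) keys_sum[of "\<lambda>i. pure_tensor (ladder i) (ladder (m - i))" "{..m}"]
    by (fastforce simp: coproduct_ladder)
  thus ?case using ab add.IH[of b] by (auto simp: ladder_forest_add ladder_forest_ladder)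
qed

lemma rtm_eq_composed_of_words:
  assumes "ladder_forest f" "\<And>w. w \<in> Poly_Mapping.keys p \<Longrightarrow> rtm f (word w) = composed f (word w)"
  shows "rtm f p = composed f p"
proof -
  have p: "p = linext word p"
    by (induction p rule: basis_induct) (simp_all add: linext_add word_def scal_single)
  have "rtm f p = linext (\<lambda>w. rtm f (word w)) p"
    by (subst p) (rule rtm_linext)
  also have "\<dots> = linext (\<lambda>w. composed f (word w)) p"
    by (rule linext_cong) (use assms(2) in auto)
  also have "\<dots> = composed f p"
    by (subst (2) p) (rule composed_linear[OF assms(1), symmetric])
  finally show ?thesis .
qed

text \<open>
  Both sides obey the coproduct rule, so only letters are at stake, and there the factorization
  chosen in the recursion is irrelevant because the ladder maps commute.
\<close>

lemma rtm_word_eq_composed: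
  "ladder_forest f \<Longrightarrow> rtm f (word w) = composed f (word w)"
\<comment> \<open>The order is the one that makes \<open>rtm_word\<close> terminate: number of nodes
  first, then word length.\<close>
proof (induction "(f, w)" arbitrary: f w rule: wf_induct_rule[OF wf_measures[of "[\<lambda>(f, w). nodes f, \<lambda>(f, w). length w]"]])
  case (1 f w)
  have IH: "rtm g (word v) = composed g (word v)"
    if "ladder_forest g" "nodes g < nodes f \<or> nodes g = nodes f \<and> length v < length w" for g v
    using 1(1)[of g v] that by auto
  show ?case
  proof (cases "f = 0 \<or> w = []")
    case True
    thus ?thesis
      using 1(2) by (auto simp: word_Nil rtm_empty rtm_one composed_one simp del: rtm_word)
         (metis composed_one composed_zero rtm_empty rtm_one word_Nil)
  next
    case False
    then obtain v u where w: "w = v @ [u]" by (metis rev_exhaust)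
    show ?thesis
    proof (cases "v = []")
      case False
      have "rtm f (word w) = linext (\<lambda>(f1, f2). rtm f1 (word v) * rtm f2 (letter u)) (coproduct f)"
        using \<open>\<not> (f = 0 \<or> w = [])\<close> by (simp add: w word_append rtm_concat del: rtm_word)
      also have "\<dots> = linext (\<lambda>(f1, f2). composed f1 (word v) * composed f2 (letter u)) (coproduct f)"
      proof (rule linext_cong)
        fix p assume p: "p \<in> Poly_Mapping.keys (coproduct f)"
        \<comment> \<open>A tensor factor may have as many nodes as \<open>f\<close>; then the word
          decreases, since \<open>v\<close> and \<open>[u]\<close> are both shorter than
          \<open>w\<close> when \<open>v\<close> is nonempty.\<close>
        have n: "nodes (fst p) + nodes (snd p) = nodes f"
          by (rule keys_coproduct) (simp add: p)
        have "rtm (fst p) (word v) = composed (fst p) (word v)"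
          by (rule IH) (use n keys_coproduct_ladder_forest[OF 1(2) p] in \<open>auto simp: w\<close>)
        moreover have "rtm (snd p) (letter u) = composed (snd p) (letter u)"
          by (rule IH) (use n False keys_coproduct_ladder_forest[OF 1(2) p] in \<open>auto simp: w\<close>)
        ultimately show "(case p of (f1, f2) \<Rightarrow> rtm f1 (word v) * rtm f2 (letter u)) =
            (case p of (f1, f2) \<Rightarrow> composed f1 (word v) * composed f2 (letter u))"
          unfolding case_prod_beta by (rule arg_cong2)
      qed simp
      also have "\<dots> = composed f (word w)"
        by (simp add: w word_append composed_mult[OF 1(2)])
      finally show ?thesis .
    next
      case True
      show ?thesis
      proof (cases "\<exists>e. f = Bplus e")
        case True
        then obtain e where "f = {#Node e#}" by (auto simp: Bplus_def)
        then obtain m where "f = ladder m" using 1(2) by (auto simp: ladder_forest_def)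
        thus ?thesis by (simp add: composed_ladder del: rtm_word)
      next
        case False
        have fact: "is_factorization f (factorization f)"
          using factorization_exists False \<open>\<not> (f = 0 \<or> w = [])\<close> by simp
        define g h where "g = fst (factorization f)" and "h = snd (factorization f)"
        have gh: "f = g + h" "g \<noteq> 0" "h \<noteq> 0"
          using fact by (auto simp: g_def h_def is_factorization_def split: prod.splits)
        have L: "ladder_forest g" "ladder_forest h"
          using 1(2) gh(1) by (simp_all add: ladder_forest_add)
        \<comment> \<open>Having fewer nodes permits words of any length, as needed for
          \<open>g\<close> acting on the polynomial \<open>rtm h (letter u)\<close>.\<close>
        have n: "nodes g < nodes f" "nodes h < nodes f"
          using gh nodes_pos by simp_all
        have "rtm f (letter u) = rtm g (rtm h (letter u))"
          using rtm_prod[OF fact] by (simp add: g_def h_def)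
        also have "\<dots> = composed g (composed h (letter u))"
          using rtm_eq_composed_of_words[OF L(1)] IH[OF L(1)] IH[OF L(2)] n by metis
        also have "\<dots> = composed f (letter u)"
          by (simp add: gh(1) composed_add[OF L(1)])
        finally show ?thesis by (simp add: w True del: rtm_word)
      qed
    qed
  qed
qed

lemma rtm_eq_composed: "ladder_forest f \<Longrightarrow> rtm f p = composed f p"
  using rtm_eq_composed_of_words rtm_word_eq_composed by blast

lemma rtm_add_ladder:
  assumes "ladder_forest f"
  shows "rtm (f + ladder m) p = rtm f (rtm (ladder m) p)"
  using assms ladder_forest_ladder
  by (simp add: rtm_eq_composed composed_add ladder_forest_add)

section \<open>The logarithm of the ladder series\<close>

lemma compositions_0: "compositions 0 n = (if n = 0 then {[]} else {})"
  by (auto simp: compositions_def)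

text \<open>Splitting off the first part matches the Cauchy product with one more factor in
  \<open>ladder_gen_power_nth\<close>.\<close>

lemma sum_compositions_Suc:
  "(\<Sum>ms\<in>compositions (Suc d) n. g ms) = (\<Sum>k=1..n. \<Sum>ms\<in>compositions d (n - k). g (k # ms))"
proof -
  have "(\<Sum>k=1..n. \<Sum>ms\<in>compositions d (n - k). g (k # ms)) =
      (\<Sum>(k, ms)\<in>Sigma {1..n} (\<lambda>k. compositions d (n - k)). g (k # ms))"
    by (rule sum.Sigma) auto
  also have "\<dots> = (\<Sum>ms\<in>compositions (Suc d) n. g ms)"
    by (rule sum.reindex_bij_witness[of _ "\<lambda>ms. (hd ms, tl ms)" "\<lambda>(k, ms). k # ms"])
       (auto simp: compositions_def length_Suc_conv)
  finally show ?thesis ..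
qed

text \<open>The ladder series minus its constant term 1, taken in the commutative algebra of forests
  rather than among maps, where commutative power series apply.\<close>

definition ladder_gen :: "(forest \<Rightarrow>\<^sub>0 rat) fps" where
  "ladder_gen = Abs_fps (\<lambda>m. if m = 0 then 0 else Poly_Mapping.single (ladder m) 1)"

lemma ladder_gen_nth: "fps_nth ladder_gen m = (if m = 0 then 0 else Poly_Mapping.single (ladder m) 1)"
  by (simp add: ladder_gen_def)

lemma ladder_gen_power_nth:
  "fps_nth (ladder_gen ^ d) n = (\<Sum>ms\<in>compositions d n. Poly_Mapping.single (\<Sum>m\<leftarrow>ms. ladder m) 1)"
proof (induction d arbitrary: n)
  case 0
  show ?case by (simp add: compositions_0)
next
  case (Suc d)
  have "fps_nth (ladder_gen ^ Suc d) n = (\<Sum>k=0..n. fps_nth ladder_gen k * fps_nth (ladder_gen ^ d) (n - k))"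
    by (simp add: fps_mult_nth)
  also have "\<dots> = (\<Sum>k=1..n. fps_nth ladder_gen k * fps_nth (ladder_gen ^ d) (n - k))"
    by (simp add: sum.atLeast_Suc_atMost ladder_gen_nth)
  also have "\<dots> = (\<Sum>k=1..n. \<Sum>ms\<in>compositions d (n - k). Poly_Mapping.single (\<Sum>m\<leftarrow>k # ms. ladder m) 1)"
    by (rule sum.cong) (simp_all add: Suc ladder_gen_nth sum_distrib_left mult_single)
  finally show ?case by (simp only: sum_compositions_Suc)
qed

lemma compositions_empty: "n < d \<Longrightarrow> compositions d n = {}"
proof -
  have "length ms \<le> sum_list ms" if "\<forall>m\<in>set ms. m \<ge> 1" for ms :: "nat list"
    using that by (induction ms) auto
  thus "n < d \<Longrightarrow> compositions d n = {}" by (fastforce simp: compositions_def)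
qed

text \<open>The coefficient of T^n in log(1 + \<open>ladder_gen\<close>).\<close>

definition log_coeff :: "nat \<Rightarrow> forest \<Rightarrow>\<^sub>0 rat" where
  "log_coeff n = (\<Sum>d=1..n. \<Sum>ms\<in>compositions d n. Poly_Mapping.single (\<Sum>m\<leftarrow>ms. ladder m) ((- 1) ^ (d + 1) / of_nat d))"

text \<open>Powers of \<open>ladder_gen\<close> beyond the n-th do not reach degree n, so one
  truncated logarithm has the right coefficients in all degrees up to \<open>N\<close>.\<close>

lemma log_coeff_eq_fps_nth:
  assumes "n \<le> N"
  shows "log_coeff n = fps_nth (\<Sum>d=1..N. fps_const (Poly_Mapping.single 0 ((- 1) ^ (d + 1) / of_nat d)) * ladder_gen ^ d) n"
proof -
  have "log_coeff n = (\<Sum>d=1..N. \<Sum>ms\<in>compositions d n. Poly_Mapping.single (\<Sum>m\<leftarrow>ms. ladder m) ((- 1) ^ (d + 1) / of_nat d))"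
    unfolding log_coeff_def
    by (rule sum.mono_neutral_left) (use assms in \<open>auto simp: compositions_empty\<close>)
  thus ?thesis
    by (simp add: fps_sum_nth ladder_gen_power_nth sum_distrib_left mult_single)
qed

text \<open>The coefficient form of T F' = (T L') F for F = 1 + \<open>ladder_gen\<close> and L =
  log F, the same shape as \<open>ladder_recursion\<close>.\<close>

lemma log_coeff_recursion:
  "of_nat n * Poly_Mapping.single (ladder n) 1 =
    (\<Sum>k=0..n. of_nat k * log_coeff k * Poly_Mapping.single (ladder (n - k)) 1)"
proof -
  define c :: "nat \<Rightarrow> forest \<Rightarrow>\<^sub>0 rat" where "c d = Poly_Mapping.single 0 ((- 1) ^ (d + 1) / of_nat d)" for d
  define L where "L = (\<Sum>d=1..n. fps_const (c d) * ladder_gen ^ d)"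
  have c: "c (Suc d) * of_nat (Suc d) = (- 1) ^ d" for d
  proof -
    have "(of_nat k :: forest \<Rightarrow>\<^sub>0 rat) = Poly_Mapping.single 0 (of_nat k)" for k
      by simp
    moreover have "((- 1) ^ k :: forest \<Rightarrow>\<^sub>0 rat) = Poly_Mapping.single 0 ((- 1) ^ k)" for k
      by (induction k) (simp_all add: mult_single flip: single_uminus single_one)
    ultimately show ?thesis by (simp only: c_def mult_single) simp
  qed
  have neg_power: "(- ladder_gen) ^ d = fps_const ((- 1) ^ d) * ladder_gen ^ d" for d
    by (induction d) (simp_all add: mult_ac flip: fps_const_neg)
  have "fps_deriv L = (\<Sum>d=1..n. fps_const (c d * of_nat d) * fps_deriv ladder_gen * ladder_gen ^ (d - 1))"
    by (simp add: L_def fps_deriv_sum fps_deriv_power mult_ac flip: fps_const_mult)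
  also have "\<dots> = (\<Sum>d<n. fps_const (c (Suc d) * of_nat (Suc d)) * fps_deriv ladder_gen * ladder_gen ^ d)"
    by (simp add: sum.atLeast1_atMost_eq)
  also have "\<dots> = fps_deriv ladder_gen * (\<Sum>d<n. (- ladder_gen) ^ d)"
    unfolding c neg_power by (simp add: sum_distrib_left mult_ac)
  \<comment> \<open>The derivative of the truncated logarithm is a finite geometric sum, so
    multiplication by 1 + \<open>ladder_gen\<close> leaves a remainder with the n-th power.\<close>
  finally have "fps_deriv L * (1 + ladder_gen) = fps_deriv ladder_gen * (1 - (- ladder_gen) ^ n)"
    using one_diff_power_eq[of "- ladder_gen" n] by (simp add: mult_ac)
  hence eq: "fps_X * fps_deriv L * (1 + ladder_gen) = fps_X * fps_deriv ladder_gen - fps_X * fps_deriv ladder_gen * (- ladder_gen) ^ n"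
    by (simp add: right_diff_distrib mult.assoc)
  have euler: "fps_nth (fps_X * fps_deriv F) k = of_nat k * fps_nth F k" for F :: "(forest \<Rightarrow>\<^sub>0 rat) fps" and k
    by (cases k) simp_all
  \<comment> \<open>The remainder starts in degree n + 1: the n-th power of
    \<open>ladder_gen\<close> contributes at least n and the other factor at least 1.\<close>
  have "fps_nth (fps_X * fps_deriv ladder_gen * (- ladder_gen) ^ n) n = 0"
  proof -
    have "fps_nth (fps_X * fps_deriv ladder_gen) k * fps_nth ((- ladder_gen) ^ n) (n - k) = 0" if "k \<le> n" for k
    proof (cases "k = 0")
      case False
      have "fps_nth (ladder_gen ^ n) (n - k) = 0"
        using False that by (simp add: ladder_gen_power_nth compositions_empty)
      thus ?thesis by (simp add: neg_power)
    qed (simp add: euler)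
    thus ?thesis by (simp add: fps_mult_nth)
  qed
  hence "fps_nth (fps_X * fps_deriv L * (1 + ladder_gen)) n = of_nat n * fps_nth ladder_gen n"
    unfolding eq by (simp add: euler)
  moreover have "fps_nth (fps_X * fps_deriv L * (1 + ladder_gen)) n =
      (\<Sum>k=0..n. of_nat k * log_coeff k * Poly_Mapping.single (ladder (n - k)) 1)"
    unfolding fps_mult_nth[of "fps_X * fps_deriv L"] euler
  proof (rule sum.cong)
    fix k assume "k \<in> {0..n}"
    hence "fps_nth L k = log_coeff k"
      using log_coeff_eq_fps_nth[of k n] by (simp add: L_def c_def)
    moreover have "fps_nth (1 + ladder_gen) (n - k) = Poly_Mapping.single (ladder (n - k)) 1"
      by (simp add: ladder_gen_nth flip: single_one)
    ultimately show "of_nat k * fps_nth L k * fps_nth (1 + ladder_gen) (n - k) =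
        of_nat k * log_coeff k * Poly_Mapping.single (ladder (n - k)) 1" by simp
  qed simp
  moreover have "of_nat n * fps_nth ladder_gen n = of_nat n * Poly_Mapping.single (ladder n) 1"
    by (simp add: ladder_gen_nth)
  ultimately show ?thesis by simp
qed

section \<open>Comparison of the logarithm with the derivations\<close>

definition act :: "(forest \<Rightarrow>\<^sub>0 rat) \<Rightarrow> ncpoly \<Rightarrow> ncpoly" where
  "act h p = linext (\<lambda>f. rtm f p) h"

lemma act_sum: "act (\<Sum>i\<in>A. h i) p = (\<Sum>i\<in>A. act (h i) p)"
  by (simp add: act_def linext_sum)

lemma act_of_nat_mult: "act (of_nat k * h) p = of_nat k * act h p"
  by (induction k) (simp_all add: act_def distrib_right linext_add)

lemma act_single: "act (Poly_Mapping.single f c) p = scal c (rtm f p)"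
  by (simp add: act_def)

lemma act_log_coeff:
  "act (log_coeff n) p = (\<Sum>d=1..n. scal ((- 1) ^ (d + 1) / of_nat d)
     (\<Sum>ms\<in>compositions d n. rtm (\<Sum>m\<leftarrow>ms. ladder m) p))"
  by (simp add: log_coeff_def act_sum act_single scal_sum)

text \<open>\<open>log_coeff n\<close> is supported on ladder forests, for which a product of
  forests acts as the composition.\<close>

lemma act_log_coeff_mult:
  "act (log_coeff n * Poly_Mapping.single (ladder m) 1) p = act (log_coeff n) (rtm (ladder m) p)"
  by (simp add: log_coeff_def sum_distrib_right act_sum act_single mult_single rtm_add_ladder ladder_forest_sum_list)

text \<open>Both families satisfy the same recursion against the ladder maps, and the map of
  \<open>ladder 0\<close> is the identity, so the recursion determines its n-th term from the
  earlier ones. The polynomial varies because earlier terms are applied to ladder images of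
  \<open>p\<close>.\<close>

lemma act_log_coeff_eq_derivation:
  "of_nat n * act (log_coeff n) p = of_nat (mersenne n) * derivation n p"
proof (induction n arbitrary: p rule: less_induct)
  case (less n)
  have "(\<Sum>k=0..n. of_nat k * act (log_coeff k) (rtm (ladder (n - k)) p)) = of_nat n * rtm (ladder n) p"
    using arg_cong[OF log_coeff_recursion[of n], of "\<lambda>h. act h p"]
    by (simp add: act_sum act_of_nat_mult act_single act_log_coeff_mult mult.assoc)
  also have "\<dots> = (\<Sum>k=0..n. of_nat (mersenne k) * derivation k (rtm (ladder (n - k)) p))"
    by (rule ladder_recursion)
  finally have "(\<Sum>k<n. of_nat k * act (log_coeff k) (rtm (ladder (n - k)) p)) + of_nat n * act (log_coeff n) p =
      (\<Sum>k<n. of_nat (mersenne k) * derivation k (rtm (ladder (n - k)) p)) + of_nat (mersenne n) * derivation n p"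
    by (simp add: atLeast0AtMost rtm_empty flip: lessThan_Suc_atMost)
  thus ?case by (simp add: less)
qed

theorem theorem1p4:
  fixes n :: nat
  assumes "n \<ge> 1"
  shows "derivation n =
    (\<lambda>p. scal (of_nat n / (2 ^ n - 1))
      (\<Sum>d = 1..n. scal ((- 1) ^ (d + 1) / of_nat d)
        (\<Sum>ms \<in> compositions d n. rtm (\<Sum>m\<leftarrow>ms. ladder m) p)))"
proof
  fix p
  have m: "(of_nat (mersenne n) :: rat) = 2 ^ n - 1"
    by (simp add: mersenne_def of_nat_diff)
  \<comment> \<open>For n at least 1 the weight 2^n - 1 is nonzero and can be divided out.\<close>
  have "(1 :: rat) < 2 ^ n"
    using assms by (intro one_less_power) simp_all
  hence "(2 :: rat) ^ n \<noteq> 1"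
    by (rule less_imp_neq[THEN not_sym])
  hence "derivation n p = scal (1 / (2 ^ n - 1)) (scal (of_nat (mersenne n)) (derivation n p))"
    by (simp add: scal_scal m)
  also have "\<dots> = scal (of_nat n / (2 ^ n - 1)) (act (log_coeff n) p)"
    by (simp add: scal_of_nat scal_scal flip: act_log_coeff_eq_derivation) (simp add: scal_scal flip: scal_of_nat)
  finally show "derivation n p = scal (of_nat n / (2 ^ n - 1))
      (\<Sum>d = 1..n. scal ((- 1) ^ (d + 1) / of_nat d)
        (\<Sum>ms \<in> compositions d n. rtm (\<Sum>m\<leftarrow>ms. ladder m) p))"
    unfolding act_log_coeff .
qed

end
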